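(* Let $f$ and $g$ be as defined in the context. Then $f(n,a)=f(n+1,a)$ holds for every $a,n\in\mathbb{N}^+$ with $n\ge\lceil\log_2 a\rceil+1$ if and only if $g(n',m)=g(n'+1,m)$ holds for every $m,n'\in\mathbb{N}^+$ with $m\ge2$ and $n'\ge\lceil\log_2 m\rceil$.
   Context: A family $\mathcal{F}$ on ground set $[n]=\{1,\dots,n\}$ is a collection $\mathcal{S}(\mathcal{F})$ of distinct subsets of $[n]$ (elements of $[n]$ may lie in no set); $m(\mathcal{F})=|\mathcal{S}(\mathcal{F})|$. It is union-closed if $S\cup T\in\mathcal{S}(\mathcal{F})$ whenever $S,T\in\mathcal{S}(\mathcal{F})$. For $e\in[n]$, $m_e(\mathcal{F})$ is the number of sets of $\mathcal{F}$ containing $e$, and $a(\mathcal{F})=\max_{e\in[n]}m_e(\mathcal{F})$. For $n,a\in\mathbb{N}^+$, $f(n,a)$ is the maximum of $m(\mathcal{F})$ over all union-closed families $\mathcal{F}$ on ground set $[n]$ with $\mathcal{S}(\mathcal{F})\neq\emptyset$ and $a(\mathcal{F})\le a$. For $n,m\in\mathbb{N}^+$ with $m\ge2$ and $m\le 2^n$, $g(n,m)$ is the minimum of $a(\mathcal{F})$ over all union-closed families $\mathcal{F}$ on ground set $[n]$ with $m(\mathcal{F})=m$. *)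

theory Defs
  imports Complex_Main
begin

definition union_closed :: "nat set set \<Rightarrow> bool" where
  "union_closed F \<longleftrightarrow> (\<forall>S\<in>F. \<forall>T\<in>F. S \<union> T \<in> F)"

text \<open>A family on the ground set \<open>{1..n}\<close> is represented by its set of members; the number of
  members is \<^term>\<open>card F\<close>. Members need not cover the ground set, so \<open>n\<close> is not
  determined by \<open>F\<close> and is passed explicitly where it matters.\<close>

definition families_on :: "nat \<Rightarrow> nat set set set" where
  "families_on n = {F. F \<subseteq> Pow {1..n}}"

definition element_freq :: "nat set set \<Rightarrow> nat \<Rightarrow> nat" where
  "element_freq F e = card {S \<in> F. e \<in> S}"

definition max_freq :: "nat \<Rightarrow> nat set set \<Rightarrow> nat" where
  "max_freq n F = Max (element_freq F ` {1..n})"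

text \<open>The maximum in \<open>uc_f\<close> is always over a nonempty finite set (the family \<open>{{}}\<close> qualifies)
  when \<open>n \<ge> 1\<close>. The minimum in \<open>uc_g\<close> is over a nonempty set when
  \<open>n \<ge> 1\<close> and \<open>m \<le> 2 ^ n\<close>; the values are not meaningful otherwise.\<close>

definition uc_f :: "nat \<Rightarrow> nat \<Rightarrow> nat" where
  "uc_f n a = Max {card F | F. F \<in> families_on n \<and> union_closed F \<and> F \<noteq> {} \<and> max_freq n F \<le> a}"

definition uc_g :: "nat \<Rightarrow> nat \<Rightarrow> nat" where
  "uc_g n m = Min {max_freq n F | F. F \<in> families_on n \<and> union_closed F \<and> card F = m}"

end

theory Submission
  imports Defs
begin

text \<open>Deleting a member of minimal size keeps a family union-closed, so both \<open>f(n,a) \<ge> m\<close> and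
  \<open>g(n,m) \<le> a\<close> say that some union-closed family on \<open>[n]\<close> has \<open>m\<close> members and frequencies at most
  \<open>a\<close>. The equivalence is then formal, except when \<open>f(n+1,a) > 2^n\<close> with \<open>a \<le> 2^(n-1)\<close> has to be
  excluded. In that case there is a family with \<open>m = 2^n + 1\<close> members and frequencies at most
  \<open>2^(n-1)\<close>. Its \<open>(k+1)\<close>-st power on disjoint copies of the ground set has \<open>m^(k+1)\<close> members and
  frequencies at most \<open>2^(n-1) m^k\<close>. If \<open>k+1\<close> is the least exponent with
  \<open>m^(k+1) \<ge> 2^(n(k+1)+1)\<close>, then this bound is below \<open>2^(n(k+1))\<close>, whereas stability of \<open>g\<close>
  forces a family with \<open>2^(n(k+1)+1)\<close> members to have frequency at least \<open>2^(n(k+1))\<close>.\<close>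

section \<open>Families of prescribed size with bounded frequencies\<close>

text \<open>The bound is imposed element by element, so that it keeps its meaning on an empty ground
  set, where \<open>max_freq\<close> would be a maximum over nothing.\<close>

definition uc_family :: "nat \<Rightarrow> nat \<Rightarrow> nat \<Rightarrow> nat set set \<Rightarrow> bool" where
  "uc_family n m a F \<longleftrightarrow> F \<in> families_on n \<and> union_closed F \<and> card F = m
     \<and> (\<forall>e\<in>{1..n}. element_freq F e \<le> a)"

definition uc_realizable :: "nat \<Rightarrow> nat \<Rightarrow> nat \<Rightarrow> bool" where
  "uc_realizable n m a \<longleftrightarrow> (\<exists>F. uc_family n m a F)"

lemma families_on_subset: "F \<in> families_on n \<Longrightarrow> S \<in> F \<Longrightarrow> S \<subseteq> {1..n}"
  by (auto simp: families_on_def)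

lemma finite_families_on: "finite (families_on n)"
  by (simp add: families_on_def flip: Pow_def)

lemma finite_family: "F \<in> families_on n \<Longrightarrow> finite F"
  by (auto simp: families_on_def intro: finite_subset)

lemma card_family_le: "F \<in> families_on n \<Longrightarrow> card F \<le> 2 ^ n"
  using card_mono[of "Pow {1..n}" F] by (simp add: families_on_def card_Pow)

lemma element_freq_mono: "finite F \<Longrightarrow> G \<subseteq> F \<Longrightarrow> element_freq G e \<le> element_freq F e"
  unfolding element_freq_def by (intro card_mono) auto

lemma max_freq_le_iff:
  "n \<ge> 1 \<Longrightarrow> max_freq n F \<le> a \<longleftrightarrow> (\<forall>e\<in>{1..n}. element_freq F e \<le> a)"
  by (simp add: max_freq_def)

text \<open>Inserting \<open>e\<close> maps the subsets avoiding \<open>e\<close> bijectively onto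
  those containing it.\<close>

lemma element_freq_Pow:
  assumes "e \<in> {1..n}"
  shows "element_freq (Pow {1..n}) e = 2 ^ (n - 1)"
proof -
  have "{S \<in> Pow {1..n}. e \<in> S} = insert e ` Pow ({1..n} - {e})"
  proof (intro equalityI subsetI)
    fix S assume "S \<in> {S \<in> Pow {1..n}. e \<in> S}"
    then have "S = insert e (S - {e})" "S - {e} \<in> Pow ({1..n} - {e})" by auto
    then show "S \<in> insert e ` Pow ({1..n} - {e})" by blast
  qed (use assms in auto)
  moreover have "inj_on (insert e) (Pow ({1..n} - {e}))"
    by (auto simp: inj_on_def)
  ultimately show ?thesis
    using assms by (simp add: element_freq_def card_image card_Pow)
qed

section \<open>Extreme cases and monotonicity of realizability\<close>

lemma uc_realizable_le_power: "uc_realizable n m a \<Longrightarrow> m \<le> 2 ^ n"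
  by (auto simp: uc_realizable_def uc_family_def card_family_le)

lemma uc_realizable_freq_mono: "uc_realizable n m a \<Longrightarrow> a \<le> b \<Longrightarrow> uc_realizable n m b"
  unfolding uc_realizable_def uc_family_def by (blast intro: order_trans)

lemma uc_realizable_one: "uc_realizable n 1 a"
  unfolding uc_realizable_def uc_family_def
  by (rule exI[of _ "{{}}"]) (auto simp: families_on_def union_closed_def element_freq_def cong: conj_cong)

text \<open>A family of this size must be the whole power set, so its frequencies are known; the
  lower bound is read off at the element 1.\<close>

lemma uc_realizable_full_iff:
  assumes "n \<ge> 1"
  shows "uc_realizable n (2 ^ n) a \<longleftrightarrow> 2 ^ (n - 1) \<le> a"
proof -
  have full: "F = Pow {1..n}" if "F \<in> families_on n" "card F = 2 ^ n" for F
    using that by (intro card_subset_eq) (auto simp: families_on_def card_Pow)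
  have "uc_family n (2 ^ n) a F \<longleftrightarrow> F = Pow {1..n} \<and> 2 ^ (n - 1) \<le> a" for F
  proof
    assume F: "uc_family n (2 ^ n) a F"
    then have "F = Pow {1..n}" unfolding uc_family_def by (metis full)
    moreover have "element_freq F 1 \<le> a" using F assms by (simp add: uc_family_def)
    ultimately show "F = Pow {1..n} \<and> 2 ^ (n - 1) \<le> a"
      using assms element_freq_Pow[of 1 n] by simp
  next
    assume F: "F = Pow {1..n} \<and> 2 ^ (n - 1) \<le> a"
    then have "\<forall>e\<in>{1..n}. element_freq F e \<le> a"
      by (metis element_freq_Pow)
    then show "uc_family n (2 ^ n) a F"
      using F by (auto simp: uc_family_def families_on_def union_closed_def card_Pow)
  qed
  then show ?thesis by (simp add: uc_realizable_def)
qed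

text \<open>The same family works: the new element lies in none of its members.\<close>

lemma uc_realizable_Suc_ground:
  assumes "uc_realizable n m a"
  shows "uc_realizable (n + 1) m a"
proof -
  obtain F where F: "uc_family n m a F" using assms by (auto simp: uc_realizable_def)
  have "{S \<in> F. n + 1 \<in> S} = {}"
    using F families_on_subset[of F n] by (fastforce simp: uc_family_def)
  then have "element_freq F (n + 1) \<le> a"
    unfolding element_freq_def by (metis card.empty le0)
  moreover have "F \<in> families_on (n + 1)"
    using F by (fastforce simp: uc_family_def families_on_def)
  ultimately have "uc_family (n + 1) m a F"
    using F by (auto simp: uc_family_def le_Suc_eq)
  then show ?thesis by (auto simp: uc_realizable_def)
qed

lemma uc_realizable_pred:
  assumes "uc_realizable n (Suc m) a"
  shows "uc_realizable n m a"
proof -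
  obtain F where F: "uc_family n (Suc m) a F" using assms by (auto simp: uc_realizable_def)
  then have fam: "F \<in> families_on n" and uc: "union_closed F" and c: "card F = Suc m"
    and fr: "\<forall>e\<in>{1..n}. element_freq F e \<le> a" by (auto simp: uc_family_def)
  have fin: "finite F" and ne: "F \<noteq> {}"
    using c by (auto intro: card_ge_0_finite)
  obtain M where M: "M \<in> F" "\<forall>S\<in>F. S \<subseteq> M \<longrightarrow> S = M"
    using finite_has_minimal[OF fin ne] by metis
  have "uc_family n m a (F - {M})"
    unfolding uc_family_def
  proof (intro conjI ballI)
    show "F - {M} \<in> families_on n" using fam by (auto simp: families_on_def)
    show "union_closed (F - {M})"
      unfolding union_closed_def
    proof (intro ballI)
      fix S T assume ST: "S \<in> F - {M}" "T \<in> F - {M}"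
      \<comment> \<open>Minimality under inclusion suffices: if the union were \<open>M\<close>,
        then \<open>S\<close> would be contained in \<open>M\<close>, hence equal to it.\<close>
      then have "S \<union> T \<noteq> M" using M(2) by blast
      then show "S \<union> T \<in> F - {M}" using ST uc by (auto simp: union_closed_def)
    qed
    show "card (F - {M}) = m" using c M(1) fin by simp
    show "element_freq (F - {M}) e \<le> a" if "e \<in> {1..n}" for e
      using fr that element_freq_mono[OF fin, of "F - {M}" e] by (meson Diff_subset order_trans)
  qed
  then show ?thesis by (auto simp: uc_realizable_def)
qed

lemma uc_realizable_antimono:
  "k \<le> m \<Longrightarrow> uc_realizable n m a \<Longrightarrow> uc_realizable n k a"
  by (induction rule: inc_induct) (auto dest: uc_realizable_pred)

section \<open>Products and powers of families\<close>

text \<open>Unite each member of one family with each member of a shifted copy of the other. An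
  element of one block imposes a condition on one factor only and leaves the other factor
  free.\<close>

lemma uc_realizable_prod:
  assumes "uc_realizable n\<^sub>1 m\<^sub>1 a\<^sub>1" "uc_realizable n\<^sub>2 m\<^sub>2 a\<^sub>2"
  shows "uc_realizable (n\<^sub>1 + n\<^sub>2) (m\<^sub>1 * m\<^sub>2) (max (a\<^sub>1 * m\<^sub>2) (m\<^sub>1 * a\<^sub>2))"
proof -
  obtain F G where F: "uc_family n\<^sub>1 m\<^sub>1 a\<^sub>1 F" and G: "uc_family n\<^sub>2 m\<^sub>2 a\<^sub>2 G"
    using assms by (auto simp: uc_realizable_def)
  define h where "h = (\<lambda>(S, T). S \<union> (+) n\<^sub>1 ` T)"
  have FS: "S \<subseteq> {1..n\<^sub>1}" if "S \<in> F" for S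
    using F that families_on_subset unfolding uc_family_def by blast
  have GT: "T \<subseteq> {1..n\<^sub>2}" if "T \<in> G" for T
    using G that families_on_subset unfolding uc_family_def by blast
  \<comment> \<open>The blocks are disjoint because ground sets start at 1: every shifted element
    exceeds \<open>n\<^sub>1\<close>.\<close>
  have low: "e \<in> h (S, T) \<longleftrightarrow> e \<in> S" if "e \<le> n\<^sub>1" "T \<in> G" for e S T
    using that GT[of T] by (force simp: h_def)
  have high: "n\<^sub>1 + e \<in> h (S, T) \<longleftrightarrow> e \<in> T" if "e \<ge> 1" "S \<in> F" for e S T
    using that FS[of S] by (force simp: h_def)
  have inj: "inj_on h (F \<times> G)"
  proof (rule inj_onI, clarify)
    fix S T S' T'
    assume *: "S \<in> F" "T \<in> G" "S' \<in> F" "T' \<in> G" "h (S, T) = h (S', T')"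
    have "e \<in> S \<longleftrightarrow> e \<in> S'" for e
      using * low[of e T S] low[of e T' S'] FS[of S] FS[of S'] by (cases "e \<le> n\<^sub>1") auto
    moreover have "e \<in> T \<longleftrightarrow> e \<in> T'" for e
      using * high[of e S T] high[of e S' T'] GT[of T] GT[of T'] by (cases "e \<ge> 1") auto
    ultimately show "S = S' \<and> T = T'" by blast
  qed
  let ?H = "h ` (F \<times> G)"
  have freq: "element_freq ?H e = card {p \<in> F \<times> G. e \<in> h p}" for e
  proof -
    have "{S \<in> ?H. e \<in> S} = h ` {p \<in> F \<times> G. e \<in> h p}" by auto
    then show ?thesis
      unfolding element_freq_def using inj by (simp add: card_image inj_on_subset)
  qed
  have "uc_family (n\<^sub>1 + n\<^sub>2) (m\<^sub>1 * m\<^sub>2) (max (a\<^sub>1 * m\<^sub>2) (m\<^sub>1 * a\<^sub>2)) ?H"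
    unfolding uc_family_def
  proof (intro conjI ballI)
    show "?H \<in> families_on (n\<^sub>1 + n\<^sub>2)"
      using FS GT by (fastforce simp: families_on_def h_def)
    show "union_closed ?H"
      unfolding union_closed_def
    proof (intro ballI)
      fix A B assume "A \<in> ?H" "B \<in> ?H"
      then obtain S T S' T' where *: "S \<in> F" "T \<in> G" "S' \<in> F" "T' \<in> G"
        "A = h (S, T)" "B = h (S', T')" by auto
      then have "A \<union> B = h (S \<union> S', T \<union> T')" by (auto simp: h_def)
      moreover have "S \<union> S' \<in> F" "T \<union> T' \<in> G"
        using * F G by (auto simp: uc_family_def union_closed_def)
      ultimately show "A \<union> B \<in> ?H" by auto
    qed
    show "card ?H = m\<^sub>1 * m\<^sub>2"
      using inj F G by (simp add: card_image uc_family_def card_cartesian_product)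
    fix e assume e: "e \<in> {1..n\<^sub>1 + n\<^sub>2}"
    show "element_freq ?H e \<le> max (a\<^sub>1 * m\<^sub>2) (m\<^sub>1 * a\<^sub>2)"
    proof (cases "e \<le> n\<^sub>1")
      case True
      have "{p \<in> F \<times> G. e \<in> h p} = {S \<in> F. e \<in> S} \<times> G"
        using low[OF True] by auto
      then have "element_freq ?H e = element_freq F e * m\<^sub>2"
        using G unfolding freq by (simp add: card_cartesian_product element_freq_def uc_family_def)
      also have "\<dots> \<le> a\<^sub>1 * m\<^sub>2"
        using F e True by (simp add: uc_family_def)
      finally show ?thesis by simp
    next
      case False
      define d where "d = e - n\<^sub>1"
      have d: "e = n\<^sub>1 + d" "d \<ge> 1" "d \<in> {1..n\<^sub>2}" using e False by (auto simp: d_def)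
      have "{p \<in> F \<times> G. e \<in> h p} = F \<times> {T \<in> G. d \<in> T}"
        using high[OF d(2)] d(1) by auto
      then have "element_freq ?H e = m\<^sub>1 * element_freq G d"
        using F unfolding freq by (simp add: card_cartesian_product element_freq_def uc_family_def)
      also have "\<dots> \<le> m\<^sub>1 * a\<^sub>2"
        using G d(3) by (simp add: uc_family_def)
      finally show ?thesis by simp
    qed
  qed
  then show ?thesis by (auto simp: uc_realizable_def)
qed

lemma uc_realizable_power:
  assumes "uc_realizable n m a"
  shows "uc_realizable (n * Suc k) (m ^ Suc k) (a * m ^ k)"
proof (induction k)
  case 0
  then show ?case using assms by simp
next
  case (Suc k)
  \<comment> \<open>Both arguments of the maximum equal \<open>a * m ^ Suc k\<close>.\<close>
  from uc_realizable_prod[OF Suc assms] show ?case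
    by (simp add: algebra_simps)
qed

section \<open>The functions f and g in terms of realizability\<close>

text \<open>The maximum is attained, and deleting members reaches every smaller positive size. Size
  0 is excluded because f ranges over nonempty families.\<close>

lemma le_uc_f_iff:
  assumes "n \<ge> 1" "m \<ge> 1"
  shows "m \<le> uc_f n a \<longleftrightarrow> uc_realizable n m a"
proof -
  define C where "C = {card F | F. F \<in> families_on n \<and> union_closed F \<and> F \<noteq> {} \<and> max_freq n F \<le> a}"
  have C_iff: "k \<in> C \<longleftrightarrow> k \<ge> 1 \<and> uc_realizable n k a" for k
  proof -
    have "card F \<ge> 1 \<longleftrightarrow> F \<noteq> {}" if "F \<in> families_on n" for F
      using finite_family[OF that] by (simp add: Suc_le_eq card_gt_0_iff)
    then show ?thesis
      by (auto simp: C_def uc_realizable_def uc_family_def max_freq_le_iff[OF assms(1)])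
  qed
  have "C \<subseteq> {..2 ^ n}" by (auto simp: C_iff dest: uc_realizable_le_power)
  then have fin: "finite C" by (rule finite_subset) simp
  have ne: "C \<noteq> {}" using C_iff[of 1] uc_realizable_one by blast
  have "m \<le> Max C \<longleftrightarrow> (\<exists>k\<in>C. m \<le> k)" using fin ne by (simp add: Max_ge_iff)
  also have "\<dots> \<longleftrightarrow> uc_realizable n m a"
    using assms(2) by (auto simp: C_iff intro: uc_realizable_antimono)
  finally show ?thesis by (simp add: uc_f_def C_def)
qed

lemma uc_g_le_iff:
  assumes "n \<ge> 1" "m \<le> 2 ^ n"
  shows "uc_g n m \<le> a \<longleftrightarrow> uc_realizable n m a"
proof -
  define C where "C = {max_freq n F | F. F \<in> families_on n \<and> union_closed F \<and> card F = m}"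
  have "C \<subseteq> max_freq n ` families_on n" by (auto simp: C_def)
  then have fin: "finite C" using finite_families_on finite_surj by blast
  \<comment> \<open>The minimum is over a nonempty set: thin out the power set to \<open>m\<close>
    members.\<close>
  have "uc_realizable n m (2 ^ (n - 1))"
    using uc_realizable_full_iff[OF assms(1)] assms(2) uc_realizable_antimono by blast
  then have ne: "C \<noteq> {}" by (auto simp: C_def uc_realizable_def uc_family_def)
  have "Min C \<le> a \<longleftrightarrow> (\<exists>b\<in>C. b \<le> a)" using fin ne by (simp add: Min_le_iff)
  also have "\<dots> \<longleftrightarrow> uc_realizable n m a"
    by (auto simp: C_def uc_realizable_def uc_family_def max_freq_le_iff[OF assms(1)])
  finally show ?thesis by (simp add: uc_g_def C_def)
qed

lemma uc_f_pos: "n \<ge> 1 \<Longrightarrow> uc_f n a \<ge> 1"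
  by (simp only: le_uc_f_iff order_refl uc_realizable_one)

lemma uc_f_mono_ground: "n \<ge> 1 \<Longrightarrow> uc_f n a \<le> uc_f (n + 1) a"
  by (metis le_add2 le_uc_f_iff order_refl uc_f_pos uc_realizable_Suc_ground)

lemma uc_g_antimono_ground:
  assumes "n \<ge> 1" "m \<le> 2 ^ n"
  shows "uc_g (n + 1) m \<le> uc_g n m"
proof -
  have "uc_realizable n m (uc_g n m)" using uc_g_le_iff[OF assms] by blast
  then show ?thesis
    using assms by (subst uc_g_le_iff) (auto intro: uc_realizable_Suc_ground[simplified])
qed

text \<open>If all frequencies vanish, only the empty set can be a member. Positivity lets the value
  of g serve as the argument \<open>a\<close> of f.\<close>

lemma uc_g_pos:
  assumes "n \<ge> 1" "m \<ge> 2" "m \<le> 2 ^ n"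
  shows "uc_g n m \<ge> 1"
proof (rule ccontr)
  assume "\<not> uc_g n m \<ge> 1"
  then obtain F where F: "uc_family n m 0 F"
    using uc_g_le_iff[OF assms(1,3), of 0] by (auto simp: uc_realizable_def)
  have "S = {}" if S: "S \<in> F" for S
  proof (rule ccontr)
    assume "S \<noteq> {}"
    then obtain e where e: "e \<in> S" by blast
    have fam: "F \<in> families_on n" using F by (simp add: uc_family_def)
    have "element_freq F e = 0" using F e families_on_subset[OF fam S] by (auto simp: uc_family_def)
    then show False
      using S e finite_family[OF fam] by (auto simp: element_freq_def)
  qed
  then have "F \<subseteq> {{}}" by blast
  then have "card F \<le> 1" using card_mono[of "{{}}" F] by simp
  then show False using F assms(2) by (simp add: uc_family_def)
qed

section \<open>Numerical facts\<close>

lemma ceiling_log2_le_iff: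
  assumes "a \<ge> 1"
  shows "\<lceil>log 2 (real a)\<rceil> \<le> int n \<longleftrightarrow> a \<le> 2 ^ n"
proof -
  have "\<lceil>log 2 (real a)\<rceil> \<le> int n \<longleftrightarrow> real a \<le> 2 powr real n"
    using assms by (simp add: ceiling_le_iff log_le_iff)
  also have "\<dots> \<longleftrightarrow> real a \<le> real (2 ^ n)" by (simp add: powr_realpow)
  finally show ?thesis by (simp only: of_nat_le_iff)
qed

text \<open>After division by powers of \<open>2 ^ n\<close>, this says that the powers of 1 + 1/2^n
  pass the value 2 between exponents \<open>k\<close> and \<open>Suc k\<close>.\<close>

lemma ex_power_crossing:
  "\<exists>k. 2 ^ (n * Suc k + 1) \<le> (2 ^ n + 1 :: nat) ^ Suc k \<and> (2 ^ n + 1 :: nat) ^ k < 2 ^ (n * k + 1)"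
proof -
  let ?P = "\<lambda>k. 2 ^ (n * k + 1) \<le> (2 ^ n + 1 :: nat) ^ k"
  \<comment> \<open>Bernoulli's inequality shows that exponent \<open>2 ^ n\<close> is already large
    enough.\<close>
  have "2 \<le> (1 + 1 / 2 ^ n :: real) ^ (2 ^ n)"
    using Bernoulli_inequality[of "1 / 2 ^ n :: real" "2 ^ n"] order_trans[of "- 1 :: real" 0 "1 / 2 ^ n"]
    by simp
  then have "2 * (2 ^ n) ^ (2 ^ n) \<le> ((1 + 1 / 2 ^ n) * 2 ^ n :: real) ^ (2 ^ n)"
    by (simp add: power_mult_distrib)
  also have "(1 + 1 / 2 ^ n) * 2 ^ n = (2 ^ n + 1 :: real)" by (simp add: field_simps)
  finally have "real (2 ^ (n * 2 ^ n + 1)) \<le> real ((2 ^ n + 1) ^ (2 ^ n))"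
    by (simp add: power_mult add.commute)
  then have "?P (2 ^ n)" by (simp only: of_nat_le_iff)
  moreover have "\<not> ?P 0" by simp
  ultimately obtain k where "\<forall>i\<le>k. \<not> ?P i" "?P (Suc k)"
    using ex_least_nat_less[of ?P "2 ^ n"] by blast
  then show ?thesis by (meson not_le order_refl)
qed

section \<open>Excluding small frequencies by taking powers\<close>

text \<open>Taking powers preserves the ratio of frequency bound to size, which is below 1/2 here.
  Trimming a suitable power to a power of two keeps it below 1/2, whereas a full power set has ratio
  exactly 1/2.\<close>

lemma not_uc_realizable_half:
  assumes stable: "\<And>n m a. n \<ge> 1 \<Longrightarrow> m \<ge> 2 \<Longrightarrow> m \<le> 2 ^ n \<Longrightarrow> uc_realizable (n + 1) m a
      \<Longrightarrow> uc_realizable n m a"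
    and n: "n \<ge> 1"
  shows "\<not> uc_realizable N (2 ^ n + 1) (2 ^ (n - 1))"
proof
  assume r: "uc_realizable N (2 ^ n + 1) (2 ^ (n - 1))"
  have descend: "uc_realizable n\<^sub>0 m a"
    if "n\<^sub>0 \<le> N\<^sub>0" "n\<^sub>0 \<ge> 1" "m \<ge> 2" "m \<le> 2 ^ n\<^sub>0" "uc_realizable N\<^sub>0 m a" for n\<^sub>0 N\<^sub>0 m a
    using that
  proof (induction N\<^sub>0 rule: dec_induct)
    case (step N\<^sub>0)
    have "m \<le> 2 ^ N\<^sub>0"
      using step.prems(3) step.hyps(1) by (meson one_le_numeral order_trans power_increasing)
    then have "uc_realizable N\<^sub>0 m a" using step stable[of N\<^sub>0 m a] by simp
    then show ?case using step by simp
  qed simp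
  obtain k where k: "2 ^ (n * Suc k + 1) \<le> (2 ^ n + 1 :: nat) ^ Suc k"
    "(2 ^ n + 1 :: nat) ^ k < 2 ^ (n * k + 1)" using ex_power_crossing by blast
  let ?d = "n * Suc k + 1"
  have "uc_realizable (N * Suc k) (2 ^ ?d) (2 ^ (n - 1) * (2 ^ n + 1) ^ k)"
    using k(1) uc_realizable_power[OF r, of k] by (rule uc_realizable_antimono)
  \<comment> \<open>So many distinct sets need at least \<open>?d\<close> elements, which makes the
    descent to \<open>?d\<close> possible.\<close>
  moreover from uc_realizable_le_power[OF this] have "?d \<le> N * Suc k"
    by (simp only: power_increasing_iff)
  moreover have "(2::nat) ^ ?d \<ge> 2" by simp
  ultimately have "uc_realizable ?d (2 ^ ?d) (2 ^ (n - 1) * (2 ^ n + 1) ^ k)"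
    using descend[of ?d "N * Suc k"] by simp
  then have "2 ^ (n * Suc k) \<le> (2::nat) ^ (n - 1) * (2 ^ n + 1) ^ k"
    using uc_realizable_full_iff[of ?d] by simp
  \<comment> \<open>Strict because exponent \<open>k\<close> is still before the crossing.\<close>
  also have "\<dots> < 2 ^ (n - 1) * 2 ^ (n * k + 1)" using k(2) by simp
  also have "\<dots> = 2 ^ (n * Suc k)"
  proof -
    have "n - 1 + (n * k + 1) = n * Suc k" using n by simp
    then show ?thesis by (metis power_add)
  qed
  finally show False by simp
qed

section \<open>The equivalence of the two stability statements\<close>

theorem theorem2p4:
  "(\<forall>a n :: nat. a \<ge> 1 \<and> n \<ge> 1 \<and> int n \<ge> \<lceil>log 2 (real a)\<rceil> + 1 \<longrightarrow> uc_f n a = uc_f (n + 1) a)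
   \<longleftrightarrow>
   (\<forall>m n' :: nat. m \<ge> 2 \<and> n' \<ge> 1 \<and> int n' \<ge> \<lceil>log 2 (real m)\<rceil> \<longrightarrow> uc_g n' m = uc_g (n' + 1) m)"
  (is "?L \<longleftrightarrow> ?R")
proof
  assume L: ?L
  show ?R
  proof (intro allI impI)
    fix m n :: nat
    assume "m \<ge> 2 \<and> n \<ge> 1 \<and> int n \<ge> \<lceil>log 2 (real m)\<rceil>"
    then have m: "m \<ge> 2" and n: "n \<ge> 1" and mn: "m \<le> 2 ^ n"
      using ceiling_log2_le_iff[of m n] by auto
    then have mn': "m \<le> 2 ^ (n + 1)" by simp
    define a where "a = uc_g (n + 1) m"
    have a1: "a \<ge> 1" using uc_g_pos[of "n + 1" m] m mn' by (simp add: a_def)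
    have "uc_g n m \<le> a"
    \<comment> \<open>Up to \<open>2 ^ (n - 1)\<close> the stability of f applies to
      \<open>a\<close>; beyond it, trimming the power set of the smaller ground set already gives a
      family.\<close>
    proof (cases "a \<le> 2 ^ (n - 1)")
      case True
      then have "int n \<ge> \<lceil>log 2 (real a)\<rceil> + 1"
        using n ceiling_log2_le_iff[OF a1, of "n - 1"] by linarith
      then have "uc_f n a = uc_f (n + 1) a" using L a1 n by blast
      moreover have "uc_realizable (n + 1) m a"
        using uc_g_le_iff[of "n + 1" m a] mn' by (simp add: a_def)
      ultimately have "uc_realizable n m a"
        using le_uc_f_iff[of n m a] le_uc_f_iff[of "n + 1" m a] n m by simp
      then show ?thesis using uc_g_le_iff[OF n mn] by simp
    next
      case False
      then have "uc_realizable n (2 ^ n) a" using uc_realizable_full_iff[OF n] by simp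
      then show ?thesis using uc_g_le_iff[OF n mn] uc_realizable_antimono[OF mn] by blast
    qed
    then show "uc_g n m = uc_g (n + 1) m"
      using uc_g_antimono_ground[OF n mn] by (simp add: a_def)
  qed
next
  assume R: ?R
  have stable: "uc_realizable n m a"
    if n: "n \<ge> 1" and m: "m \<ge> 2" and mn: "m \<le> 2 ^ n" and r: "uc_realizable (n + 1) m a" for n m a
  proof -
    have "int n \<ge> \<lceil>log 2 (real m)\<rceil>"
      using m mn ceiling_log2_le_iff[of m n] by linarith
    then have "uc_g n m = uc_g (n + 1) m" using R n m by blast
    then show ?thesis
      using uc_g_le_iff[OF n mn] uc_g_le_iff[of "n + 1" m a] mn r by simp
  qed
  show ?L
  proof (intro allI impI)
    fix a n :: nat
    assume "a \<ge> 1 \<and> n \<ge> 1 \<and> int n \<ge> \<lceil>log 2 (real a)\<rceil> + 1"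
    then have a1: "a \<ge> 1" and n: "n \<ge> 1" and an: "a \<le> 2 ^ (n - 1)"
      using ceiling_log2_le_iff[of a "n - 1"] by auto
    define m where "m = uc_f (n + 1) a"
    have m1: "m \<ge> 1" using uc_f_pos by (simp add: m_def)
    have r: "uc_realizable (n + 1) m a"
      using le_uc_f_iff[of "n + 1" m a] m1 by (simp add: m_def)
    \<comment> \<open>The stability of g concerns only sizes that fit on the smaller ground set, so
      larger \<open>m\<close> must be ruled out first.\<close>
    have mn: "m \<le> 2 ^ n"
    proof (rule ccontr)
      assume "\<not> m \<le> 2 ^ n"
      then have "2 ^ n + 1 \<le> m" by simp
      then have "uc_realizable (n + 1) (2 ^ n + 1) (2 ^ (n - 1))"
        using r an uc_realizable_freq_mono uc_realizable_antimono by blast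
      then show False using not_uc_realizable_half[OF stable n] by blast
    qed
    have "uc_realizable n m a"
    \<comment> \<open>Size 1 is treated directly, since the stability of g starts at size 2.\<close>
    proof (cases "m = 1")
      case True
      then show ?thesis using uc_realizable_one by simp
    next
      case False
      then show ?thesis using stable[OF n _ mn r] m1 by simp
    qed
    then have "m \<le> uc_f n a" using le_uc_f_iff[OF n m1] by simp
    then show "uc_f n a = uc_f (n + 1) a"
      using uc_f_mono_ground[OF n, of a] by (simp add: m_def)
  qed
qed

end
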